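(* For every ordinal $\alpha$ with $0<\alpha<\varepsilon_0$, $\mathbf{A}_\alpha=\mathbf{F}_\alpha$, where $$\mathbf{A}_\alpha=\bigcup_{p\in\mathscr F_{<\alpha}}\mathrm{DTime}\big(A_\alpha(p(n))\big),\qquad \mathbf{F}_\alpha=\bigcup_{p\in\mathscr F_{<\alpha}}\mathrm{DTime}\big(F_\alpha(p(n))\big).$$
   Context: Ordinals are below $\varepsilon_0$ and written in Cantor normal form $\alpha=\omega^{\alpha_1}c_1+\cdots+\omega^{\alpha_n}c_n$ with $\alpha>\alpha_1>\cdots>\alpha_n$ and $0<c_i<\omega$. Each limit ordinal $\lambda$ has the fundamental sequence $(\lambda(x))_{x\in\mathbb N}$ defined by $(\gamma+\omega^{\beta+1})(x)=\gamma+\omega^\beta\cdot(x+1)$ and $(\gamma+\omega^{\lambda'})(x)=\gamma+\omega^{\lambda'(x)}$ for $\lambda'$ a limit. Fast-growing functions $F_\alpha:\mathbb N\to\mathbb N$: $F_0(x)=x+1$, $F_{\alpha+1}(x)=F_\alpha^{x+1}(x)$ (the $(x+1)$-fold iterate), $F_\lambda(x)=F_{\lambda(x)}(x)$. Ackermann functions $A_\alpha:\mathbb N\to\mathbb N$ for $\alpha>0$: $A_1(x)=2x$, $A_{\alpha+1}(x)=A_\alpha^{x}(1)$, $A_\lambda(x)=A_{\lambda(x)}(x)$. Extended Grzegorczyk class $\mathscr F_\alpha$: the smallest class of functions $\mathbb N^k\to\mathbb N$ ($k\ge 0$) containing the constant zero function, addition $(x_1,x_2)\mapsto x_1+x_2$,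 all projections, and $F_\alpha$, and closed under substitution (composition) and limited primitive recursion (if $h_0,h_1,g$ are in the class and $f(0,\vec x)=h_0(\vec x)$, $f(y+1,\vec x)=h_1(y,\vec x,f(y,\vec x))$, $f(y,\vec x)\le g(\max\{y,\vec x\})$, then $f$ is in the class). $\mathscr F_{<\alpha}=\bigcup_{\beta<\alpha}\mathscr F_\beta$; in the unions above $p$ ranges over unary functions. $\mathrm{DTime}(t(n))$ is the class of languages decided by a deterministic Turing machine in at most $t(n)$ steps on inputs of length $n$. *)

theory Defs
  imports Main
begin

section \<open>Ordinals below \<open>\<epsilon>\<^sub>0\<close>\<close>

text \<open>
  \<open>Cnf [a\<^sub>1, \<dots>, a\<^sub>n]\<close> denotes \<open>\<omega>^a\<^sub>1 + \<dots> + \<omega>^a\<^sub>n\<close>. A coefficient \<open>c\<close> is written as \<open>c\<close> repetitions of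
  its exponent, so a term is in Cantor normal form iff, hereditarily, the exponents are weakly
  decreasing. The condition that the exponents lie below the ordinal itself characterises the
  ordinals below \<open>\<epsilon>\<^sub>0\<close>; it holds automatically for these finite terms.
\<close>

datatype ordn = Cnf (exps: "ordn list")

instantiation ordn :: "{zero, one}"
begin
definition zero_ordn :: ordn where "0 = Cnf []"
definition one_ordn :: ordn where "1 = Cnf [0]"
instance ..
end

text \<open>On terms in Cantor normal form, the order of the ordinals is the hereditary lexicographic one.\<close>

fun ordn_less :: "ordn \<Rightarrow> ordn \<Rightarrow> bool" where
  "ordn_less _ (Cnf []) \<longleftrightarrow> False"
| "ordn_less (Cnf []) (Cnf (b # bs)) \<longleftrightarrow> True"
| "ordn_less (Cnf (a # as)) (Cnf (b # bs)) \<longleftrightarrow>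
     ordn_less a b \<or> a = b \<and> ordn_less (Cnf as) (Cnf bs)"

lemma ordn_less_irrefl: "\<not> ordn_less a a"
proof (induction a)
  case (Cnf as)
  then show ?case by (induction as) auto
qed

lemma ordn_less_trans: "ordn_less a b \<Longrightarrow> ordn_less b c \<Longrightarrow> ordn_less a c"
proof (induction a b arbitrary: c rule: ordn_less.induct)
  case (2 b bs)
  then show ?case by (cases c rule: ordn.exhaust) (metis ordn_less.simps(1,2) neq_Nil_conv)
next
  case (3 a as b bs)
  obtain ds where c: "c = Cnf ds" by (cases c)
  then show ?case using 3 by (cases ds) auto
qed simp

lemma ordn_less_total: "ordn_less a b \<or> a = b \<or> ordn_less b a"
proof (induction a b rule: ordn_less.induct)
  case (1 a)
  obtain as where "a = Cnf as" by (cases a)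
  then show ?case by (cases as) auto
qed auto

instantiation ordn :: linorder
begin
definition less_ordn :: "ordn \<Rightarrow> ordn \<Rightarrow> bool" where "a < b \<longleftrightarrow> ordn_less a b"
definition less_eq_ordn :: "ordn \<Rightarrow> ordn \<Rightarrow> bool" where "a \<le> b \<longleftrightarrow> ordn_less a b \<or> a = b"
instance
  by standard
    (use ordn_less_irrefl ordn_less_trans ordn_less_total in
      \<open>unfold less_ordn_def less_eq_ordn_def; blast\<close>)+
end

fun cnf :: "ordn \<Rightarrow> bool" where
  "cnf (Cnf as) \<longleftrightarrow> sorted_wrt (\<ge>) as \<and> (\<forall>a \<in> set as. cnf a)"

text \<open>\<open>add_pow \<gamma> \<beta> n\<close> is \<open>\<gamma> + \<omega>^\<beta> \<cdot> n\<close>, provided the resulting term is in Cantor normal form.\<close>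

definition add_pow :: "ordn \<Rightarrow> ordn \<Rightarrow> nat \<Rightarrow> ordn" where
  "add_pow \<gamma> \<beta> n = Cnf (exps \<gamma> @ replicate n \<beta>)"

definition succ :: "ordn \<Rightarrow> ordn" where
  "succ \<alpha> = add_pow \<alpha> 0 1"

definition is_succ :: "ordn \<Rightarrow> bool" where
  "is_succ \<alpha> \<longleftrightarrow> (\<exists>\<beta>. \<alpha> = succ \<beta>)"

definition is_limit :: "ordn \<Rightarrow> bool" where
  "is_limit \<alpha> \<longleftrightarrow> \<alpha> \<noteq> 0 \<and> \<not> is_succ \<alpha>"

definition pred :: "ordn \<Rightarrow> ordn" where
  "pred \<alpha> = Cnf (butlast (exps \<alpha>))"

lemma pred_succ [simp]: "pred (succ \<alpha>) = \<alpha>"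
  by (simp add: pred_def succ_def add_pow_def)

lemma succ_pred: "is_succ \<alpha> \<Longrightarrow> succ (pred \<alpha>) = \<alpha>"
  by (auto simp: is_succ_def)

lemma succ_neq_0 [simp]: "succ \<alpha> \<noteq> 0"
  by (simp add: zero_ordn_def succ_def add_pow_def)

lemma is_succ_succ [simp]: "is_succ (succ \<alpha>)"
  by (auto simp: is_succ_def)

lemma one_eq_succ_0: "1 = succ 0"
  by (simp add: one_ordn_def zero_ordn_def succ_def add_pow_def)

lemma succ_inject [simp]: "succ \<alpha> = succ \<beta> \<longleftrightarrow> \<alpha> = \<beta>"
  by (metis pred_succ)

lemma not_is_succ_0 [simp]: "\<not> is_succ 0"
  by (metis is_succ_def succ_neq_0)

lemma is_succ_iff: "is_succ \<alpha> \<longleftrightarrow> exps \<alpha> \<noteq> [] \<and> last (exps \<alpha>) = 0"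
proof
  assume "exps \<alpha> \<noteq> [] \<and> last (exps \<alpha>) = 0"
  then have "\<alpha> = succ (pred \<alpha>)"
    by (cases \<alpha>) (simp add: succ_def pred_def add_pow_def, metis append_butlast_last_id)
  then show "is_succ \<alpha>" unfolding is_succ_def by blast
qed (auto simp: is_succ_def succ_def add_pow_def)

lemma is_limit_add_pow: "is_limit (add_pow \<gamma> \<beta> 1) \<longleftrightarrow> \<beta> \<noteq> 0"
  by (simp add: is_limit_def is_succ_iff) (simp add: add_pow_def zero_ordn_def)

text \<open>Fundamental sequences; the value is relevant for limit terms only.\<close>

function fund :: "ordn \<Rightarrow> nat \<Rightarrow> ordn" where
  "fund \<alpha> x =
     (if exps \<alpha> = [] then 0 else
      let \<gamma> = Cnf (butlast (exps \<alpha>)); \<delta> = last (exps \<alpha>) in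
      if is_succ \<delta> then add_pow \<gamma> (pred \<delta>) (x + 1) else add_pow \<gamma> (fund \<delta> x) 1)"
  by auto
termination
proof (relation "measure (size \<circ> fst)")
  fix \<alpha> \<gamma> \<delta> :: ordn and x :: nat
  assume "exps \<alpha> \<noteq> []" "\<delta> = last (exps \<alpha>)"
  then have "\<delta> \<in> set (exps \<alpha>)" by simp
  then show "((\<delta>, x), (\<alpha>, x)) \<in> measure (size \<circ> fst)"
    by (cases \<alpha>) (auto dest: size_list_estimation'[OF _ order_refl, where f = size])
qed simp

declare fund.simps [simp del]

lemma fund_succ: "fund (add_pow \<gamma> (succ \<beta>) 1) x = add_pow \<gamma> \<beta> (x + 1)"
  by (subst fund.simps) (simp add: add_pow_def)

lemma fund_limit: "is_limit \<delta> \<Longrightarrow> fund (add_pow \<gamma> \<delta> 1) x = add_pow \<gamma> (fund \<delta> x) 1"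
  by (subst fund.simps) (simp add: add_pow_def is_limit_def)

text \<open>
  The recursions below descend along predecessors and fundamental sequences. This relation is
  well-founded on all terms, in normal form or not, whence the functions are total.
\<close>

inductive descent :: "ordn \<Rightarrow> ordn \<Rightarrow> bool" where
  "is_succ \<alpha> \<Longrightarrow> descent (pred \<alpha>) \<alpha>"
| "is_limit \<alpha> \<Longrightarrow> descent (fund \<alpha> x) \<alpha>"

lemma descent_accp_add_pow:
  assumes "Wellfounded.accp descent \<beta>" and "Wellfounded.accp descent \<gamma>"
  shows "Wellfounded.accp descent (add_pow \<gamma> \<beta> 1)"
  using assms
proof (induction arbitrary: \<gamma> rule: accp.induct)
  case (accI \<beta>)
  show ?case
  proof (rule accpI)
    fix \<delta> assume "descent \<delta> (add_pow \<gamma> \<beta> 1)"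
    then show "Wellfounded.accp descent \<delta>"
    proof cases
      case 1
      then have "\<beta> = 0" by (simp add: is_succ_iff) (simp add: add_pow_def)
      then have "\<delta> = \<gamma>" using 1 by (simp add: pred_def add_pow_def)
      then show ?thesis using accI.prems by simp
    next
      case (2 x)
      then have "\<beta> \<noteq> 0" using is_limit_add_pow by blast
      show ?thesis
      proof (cases "is_succ \<beta>")
        case True
        then obtain \<beta>' where \<beta>': "\<beta> = succ \<beta>'" by (auto simp: is_succ_def)
        then have d: "descent \<beta>' \<beta>" using descent.intros(1)[OF True] by simp
        have "Wellfounded.accp descent (add_pow \<gamma> \<beta>' n)" for n
        proof (induction n)
          case 0
          then show ?case using accI.prems by (simp add: add_pow_def)
        next
          case (Suc n)
          have "add_pow \<gamma> \<beta>' (Suc n) = add_pow (add_pow \<gamma> \<beta>' n) \<beta>' 1"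
            by (simp add: add_pow_def replicate_append_same)
          then show ?case using accI.IH[OF d Suc] by simp
        qed
        then show ?thesis unfolding 2(1) \<beta>' fund_succ .
      next
        case False
        then have l: "is_limit \<beta>" using \<open>\<beta> \<noteq> 0\<close> by (simp add: is_limit_def)
        show ?thesis
          unfolding 2(1) fund_limit[OF l] by (rule accI.IH[OF descent.intros(2)[OF l] accI.prems])
      qed
    qed
  qed
qed

lemma descent_accp: "Wellfounded.accp descent \<alpha>"
proof (induction \<alpha>)
  case (Cnf as)
  then show ?case
  proof (induction as rule: rev_induct)
    case Nil
    show ?case
      by (rule accpI) (auto elim!: descent.cases simp: is_limit_def is_succ_iff zero_ordn_def)
  next
    case (snoc a as)
    then show ?case using descent_accp_add_pow[of a "Cnf as"] by (simp add: add_pow_def)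
  qed
qed

lemma wfp_descent: "wfp descent"
  by (simp add: descent_accp accp_wfpI)


section \<open>Fast-growing and Ackermann functions\<close>

function fast :: "ordn \<Rightarrow> nat \<Rightarrow> nat" where
  "fast \<alpha> x =
     (if \<alpha> = 0 then x + 1
      else if is_succ \<alpha> then (fast (pred \<alpha>) ^^ (x + 1)) x
      else fast (fund \<alpha> x) x)"
  by auto
termination
  by (relation "inv_image {(\<beta>, \<alpha>). descent \<beta> \<alpha>} fst")
    (use wfp_descent in \<open>auto simp: wfp_def is_limit_def intro: descent.intros\<close>)

declare fast.simps [simp del]

lemma fast_0: "fast 0 x = x + 1"
  by (subst fast.simps) simp

lemma fast_succ: "fast (succ \<alpha>) x = (fast \<alpha> ^^ (x + 1)) x"
  by (subst fast.simps) simp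

lemma fast_limit: "is_limit \<alpha> \<Longrightarrow> fast \<alpha> x = fast (fund \<alpha> x) x"
  by (subst fast.simps) (simp add: is_limit_def)

text \<open>The Ackermann functions are indexed by positive ordinals; the value at index 0 is a dummy.\<close>

function ack :: "ordn \<Rightarrow> nat \<Rightarrow> nat" where
  "ack \<alpha> x =
     (if \<alpha> = 0 then 0
      else if \<alpha> = 1 then 2 * x
      else if is_succ \<alpha> then (ack (pred \<alpha>) ^^ x) 1
      else ack (fund \<alpha> x) x)"
  by auto
termination
  by (relation "inv_image {(\<beta>, \<alpha>). descent \<beta> \<alpha>} fst")
    (use wfp_descent in \<open>auto simp: wfp_def is_limit_def intro: descent.intros\<close>)

declare ack.simps [simp del]

lemma ack_1: "ack 1 x = 2 * x"
  by (subst ack.simps) (simp add: one_ordn_def zero_ordn_def)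

lemma ack_succ: "\<alpha> \<noteq> 0 \<Longrightarrow> ack (succ \<alpha>) x = (ack \<alpha> ^^ x) 1"
  by (subst ack.simps) (simp add: one_eq_succ_0)

lemma ack_limit: "is_limit \<alpha> \<Longrightarrow> ack \<alpha> x = ack (fund \<alpha> x) x"
  by (subst ack.simps) (auto simp: is_limit_def one_eq_succ_0)


section \<open>The extended Grzegorczyk hierarchy\<close>

text \<open>
  A function of \<open>k\<close> arguments is a function on lists, of which only the values on lists of length
  \<open>k\<close> matter (hence the rule \<open>ext\<close>); \<open>grz \<alpha> k f\<close> says that the \<open>k\<close>-ary function \<open>f\<close> belongs to
  the class with index \<open>\<alpha>\<close>.
\<close>

inductive grz :: "ordn \<Rightarrow> nat \<Rightarrow> (nat list \<Rightarrow> nat) \<Rightarrow> bool" for \<alpha> :: ordn where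
  zero: "grz \<alpha> k (\<lambda>_. 0)"
| add: "grz \<alpha> 2 (\<lambda>xs. xs ! 0 + xs ! 1)"
| proj: "i < k \<Longrightarrow> grz \<alpha> k (\<lambda>xs. xs ! i)"
| fast: "grz \<alpha> 1 (\<lambda>xs. fast \<alpha> (xs ! 0))"
| subst: "grz \<alpha> (length gs) h \<Longrightarrow> \<forall>g \<in> set gs. grz \<alpha> k g \<Longrightarrow>
    grz \<alpha> k (\<lambda>xs. h (map (\<lambda>g. g xs) gs))"
| limited_rec: "grz \<alpha> k h\<^sub>0 \<Longrightarrow> grz \<alpha> (k + 2) h\<^sub>1 \<Longrightarrow> grz \<alpha> 1 g \<Longrightarrow>
    (\<And>xs. length xs = k \<Longrightarrow> f (0 # xs) = h\<^sub>0 xs) \<Longrightarrow>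
    (\<And>y xs. length xs = k \<Longrightarrow> f (Suc y # xs) = h\<^sub>1 (y # xs @ [f (y # xs)])) \<Longrightarrow>
    (\<And>y xs. length xs = k \<Longrightarrow> f (y # xs) \<le> g [Max (set (y # xs))]) \<Longrightarrow>
    grz \<alpha> (k + 1) f"
| ext: "grz \<alpha> k f \<Longrightarrow> (\<And>xs. length xs = k \<Longrightarrow> f xs = f' xs) \<Longrightarrow> grz \<alpha> k f'"

definition grz_below :: "ordn \<Rightarrow> (nat \<Rightarrow> nat) set" where
  "grz_below \<alpha> = {p. \<exists>\<beta>. cnf \<beta> \<and> \<beta> < \<alpha> \<and> (\<exists>f. grz \<beta> 1 f \<and> p = (\<lambda>n. f [n]))}"


section \<open>Deterministic Turing machines\<close>

text \<open>
  Deterministic machines with any positive number of two-way infinite tapes. The input alphabet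
  is a finite type; states and work symbols are drawn from finite sets of natural numbers.
\<close>

datatype 'a symbol = Blank | Input 'a | Work nat

datatype move = Left | Stay | Right

record 'a tm =
  tapes :: nat
  states :: "nat set"
  alphabet :: "'a symbol set"
  start :: nat
  accept :: nat
  reject :: nat
  delta :: "nat \<Rightarrow> 'a symbol list \<Rightarrow> nat \<times> ('a symbol \<times> move) list"

definition tm :: "'a tm \<Rightarrow> bool" where
  "tm M \<longleftrightarrow>
     tapes M \<ge> 1 \<and>
     finite (states M) \<and> {start M, accept M, reject M} \<subseteq> states M \<and> accept M \<noteq> reject M \<and>
     finite (alphabet M) \<and> insert Blank (range Input) \<subseteq> alphabet M \<and>
     (\<forall>q \<in> states M. \<forall>ss. length ss = tapes M \<and> set ss \<subseteq> alphabet M \<longrightarrow>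
        (case delta M q ss of (q', acts) \<Rightarrow>
           q' \<in> states M \<and> length acts = tapes M \<and> fst ` set acts \<subseteq> alphabet M))"

text \<open>A tape consists of the head position and the contents of all cells.\<close>

type_synonym 'a tape = "int \<times> (int \<Rightarrow> 'a symbol)"
type_synonym 'a config = "nat \<times> 'a tape list"

fun offset :: "move \<Rightarrow> int" where
  "offset Left = -1"
| "offset Stay = 0"
| "offset Right = 1"

fun act :: "'a tape \<Rightarrow> 'a symbol \<times> move \<Rightarrow> 'a tape" where
  "act (i, c) (s, d) = (i + offset d, c(i := s))"

definition halted :: "'a tm \<Rightarrow> 'a config \<Rightarrow> bool" where
  "halted M C \<longleftrightarrow> fst C \<in> {accept M, reject M}"

definition step :: "'a tm \<Rightarrow> 'a config \<Rightarrow> 'a config" where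
  "step M C =
     (if halted M C then C
      else case C of (q, ts) \<Rightarrow>
        case delta M q (map (\<lambda>(i, c). c i) ts) of (q', acts) \<Rightarrow> (q', map2 act ts acts))"

definition input_tape :: "'a list \<Rightarrow> 'a tape" where
  "input_tape w = (0, \<lambda>i. if 0 \<le> i \<and> i < int (length w) then Input (w ! nat i) else Blank)"

definition start_config :: "'a tm \<Rightarrow> 'a list \<Rightarrow> 'a config" where
  "start_config M w = (start M, input_tape w # replicate (tapes M - 1) (0, \<lambda>_. Blank))"

definition decides_in_time :: "'a tm \<Rightarrow> 'a list set \<Rightarrow> (nat \<Rightarrow> nat) \<Rightarrow> bool" where
  "decides_in_time M L t \<longleftrightarrow>
     (\<forall>w. \<exists>s \<le> t (length w). let C = (step M ^^ s) (start_config M w) in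
        halted M C \<and> (fst C = accept M \<longleftrightarrow> w \<in> L))"

definition DTime :: "(nat \<Rightarrow> nat) \<Rightarrow> 'a::finite list set set" where
  "DTime t = {L. \<exists>M. tm M \<and> decides_in_time M L t}"


section \<open>The complexity classes\<close>

definition fast_class :: "ordn \<Rightarrow> 'a::finite list set set" where
  "fast_class \<alpha> = (\<Union>p \<in> grz_below \<alpha>. DTime (\<lambda>n. fast \<alpha> (p n)))"

definition ack_class :: "ordn \<Rightarrow> 'a::finite list set set" where
  "ack_class \<alpha> = (\<Union>p \<in> grz_below \<alpha>. DTime (\<lambda>n. ack \<alpha> (p n)))"

end

(*
  It suffices to compare the two families pointwise:
  A_alpha(x) <= F_alpha(x) <= A_alpha(6x + 5) for alpha > 0, since every class in the hierarchy is
  closed under p |-> 6p + 5. Both bounds go by induction along fundamental sequences. The only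
  delicate point is monotonicity in the index at limits; it follows because lambda(x) can be reached
  from lambda(y), for x <= y, by the descent that always takes the element with number 0 of a
  fundamental sequence.
*)
theory Submission imports Defs begin

section \<open>Induction along descent, and iterates\<close>

lemma ordn_induct [case_names zero succ limit]:
  assumes "P 0" and "\<And>\<beta>. P \<beta> \<Longrightarrow> P (succ \<beta>)"
    and "\<And>\<mu>. is_limit \<mu> \<Longrightarrow> (\<And>x. P (fund \<mu> x)) \<Longrightarrow> P \<mu>"
  shows "P \<alpha>"
proof (induction \<alpha> rule: wfp_induct_rule[OF wfp_descent])
  case (1 \<alpha>)
  show ?case
  proof (cases "is_succ \<alpha>")
    case True
    then have "P (pred \<alpha>)" by (intro 1 descent.intros)
    then show ?thesis using assms(2) succ_pred[OF True] by metis
  next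
    case False
    then show ?thesis
      using 1 assms(1,3) descent.intros(2) by (metis is_limit_def)
  qed
qed

lemma funpow_le_funpow:
  fixes f g :: "nat \<Rightarrow> nat"
  assumes "mono g" and "\<And>x. f x \<le> g x" and "x \<le> y"
  shows "(f ^^ n) x \<le> (g ^^ n) y"
proof (induction n)
  case (Suc n)
  have "f ((f ^^ n) x) \<le> g ((f ^^ n) x)" by (rule assms)
  also have "\<dots> \<le> g ((g ^^ n) y)" using assms(1) Suc by (rule monoD)
  finally show ?case by simp
qed (simp add: assms)

section \<open>Limit terms and descent through elements number 0\<close>

lemma limit_cases:
  assumes "is_limit \<mu>"
  obtains (succ) \<gamma> \<beta> where "\<mu> = add_pow \<gamma> (succ \<beta>) 1"
  | (limit) \<gamma> \<delta> where "\<mu> = add_pow \<gamma> \<delta> 1" "is_limit \<delta>" "\<delta> \<in> set (exps \<mu>)"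
proof -
  from assms have ne: "exps \<mu> \<noteq> []"
    by (cases \<mu>) (auto simp: is_limit_def zero_ordn_def)
  then have \<mu>: "\<mu> = add_pow (Cnf (butlast (exps \<mu>))) (last (exps \<mu>)) 1"
    by (cases \<mu>) (simp add: add_pow_def)
  moreover have "last (exps \<mu>) \<noteq> 0"
    using assms \<mu> is_limit_add_pow by metis
  \<comment> \<open>Makes the last exponent a proper subterm, so that structural induction on \<mu>
    can reach it.\<close>
  moreover have "last (exps \<mu>) \<in> set (exps \<mu>)" using ne by simp
  ultimately show thesis using succ limit by (metis is_limit_def is_succ_def)
qed

text \<open>The simplifier turns \<open>1\<close> into \<open>Suc 0\<close>, after which the rules
  stated with \<open>1\<close> no longer match.\<close>

lemmas fund_simps =
  is_limit_add_pow[unfolded One_nat_def] fund_succ[unfolded One_nat_def] fund_limit[unfolded One_nat_def]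

lemma fund_neq_0: "is_limit \<mu> \<Longrightarrow> fund \<mu> x \<noteq> 0"
  by (erule limit_cases) (simp_all add: fund_simps, simp_all add: add_pow_def zero_ordn_def)

text \<open>The element number is fixed at 0 so that the relation does not depend on an argument x:
  it will compare functions at all x at once, x = 0 included.\<close>

inductive reach0 :: "ordn \<Rightarrow> ordn \<Rightarrow> bool" where
  refl: "reach0 \<alpha> \<alpha>"
| succ: "reach0 \<alpha> \<beta> \<Longrightarrow> reach0 \<alpha> (succ \<beta>)"
| limit: "is_limit \<mu> \<Longrightarrow> reach0 \<alpha> (fund \<mu> 0) \<Longrightarrow> reach0 \<alpha> \<mu>"

lemma reach0_trans: "reach0 \<beta> \<gamma> \<Longrightarrow> reach0 \<alpha> \<beta> \<Longrightarrow> reach0 \<alpha> \<gamma>"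
  by (induction rule: reach0.induct) (auto intro: reach0.intros)

lemma reach0_0: "reach0 \<alpha> 0 \<Longrightarrow> \<alpha> = 0"
  by (erule reach0.cases) (auto simp: is_limit_def)

lemma reach0_succ: "reach0 \<alpha> (succ \<beta>) \<Longrightarrow> \<alpha> = succ \<beta> \<or> reach0 \<alpha> \<beta>"
  by (erule reach0.cases) (auto simp: is_limit_def)

lemma reach0_limit: "reach0 \<alpha> \<mu> \<Longrightarrow> is_limit \<mu> \<Longrightarrow> \<alpha> = \<mu> \<or> reach0 \<alpha> (fund \<mu> 0)"
  by (erule reach0.cases) (auto simp: is_limit_def)

text \<open>Element 0 only lowers the exponent of the last power: since the coefficient is x + 1,
  element 0 of \<open>\<gamma> + \<omega>^(\<beta>+1)\<close> is
  \<open>\<gamma> + \<omega>^\<beta>\<close>. At exponent 0 the power is removed as a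
  successor.\<close>

lemma reach0_add_pow: "reach0 \<gamma> (add_pow \<gamma> \<delta> 1)"
proof (induction \<delta> rule: ordn_induct)
  case zero
  show ?case using reach0.succ[OF reach0.refl] by (simp add: succ_def)
next
  case (succ \<beta>)
  then show ?case by - (rule reach0.limit, simp_all add: fund_simps)
next
  case (limit \<mu>)
  then show ?case
    by - (rule reach0.limit, auto simp: fund_simps, simp add: is_limit_def)
qed

lemma reach0_add_pow_mono_coeff:
  assumes "m \<le> n"
  shows "reach0 (add_pow \<gamma> \<delta> m) (add_pow \<gamma> \<delta> n)"
  using assms
proof (induction n rule: dec_induct)
  case (step n)
  have "add_pow \<gamma> \<delta> (Suc n) = add_pow (add_pow \<gamma> \<delta> n) \<delta> 1"
    by (simp add: add_pow_def replicate_append_same)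
  then show ?case using reach0_add_pow reach0_trans step.IH by metis
qed (rule reach0.refl)

text \<open>Each descent step in the exponent lifts to one step of the whole term, again because
  element 0 has coefficient 1.\<close>

lemma reach0_add_pow_mono_exp:
  "reach0 \<alpha> \<beta> \<Longrightarrow> reach0 (add_pow \<gamma> \<alpha> 1) (add_pow \<gamma> \<beta> 1)"
proof (induction rule: reach0.induct)
  case (succ \<alpha> \<beta>)
  then show ?case by - (rule reach0.limit, simp_all add: fund_simps)
next
  case (limit \<mu> \<alpha>)
  then show ?case
    by - (rule reach0.limit, auto simp: fund_simps, simp add: is_limit_def)
qed (rule reach0.refl)

text \<open>For a successor exponent only the coefficient grows with the element number; for a limit
  exponent the claim passes to that exponent.\<close>

lemma reach0_fund_mono:
  assumes "is_limit \<mu>" and "x \<le> y"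
  shows "reach0 (fund \<mu> x) (fund \<mu> y)"
  using assms(1)
proof (induction \<mu>)
  case (Cnf as)
  from Cnf.prems show ?case
  proof (cases rule: limit_cases)
    case (succ \<gamma> \<beta>)
    then show ?thesis using assms(2) by (simp add: fund_simps reach0_add_pow_mono_coeff)
  next
    case (limit \<gamma> \<delta>)
    then have "reach0 (fund \<delta> x) (fund \<delta> y)" by (metis Cnf.IH ordn.sel)
    then show ?thesis
      using limit reach0_add_pow_mono_exp by (simp add: fund_limit del: One_nat_def)
  qed
qed

lemma reach0_fund: "reach0 \<alpha> \<mu> \<Longrightarrow> is_limit \<mu> \<Longrightarrow> \<alpha> = \<mu> \<or> reach0 \<alpha> (fund \<mu> x)"
  using reach0_limit reach0_trans reach0_fund_mono by blast

section \<open>Monotonicity of the fast-growing functions\<close>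

lemma less_funpow_Suc:
  fixes f :: "nat \<Rightarrow> nat"
  assumes "\<And>x. x < f x"
  shows "x < (f ^^ Suc n) x"
proof (induction n)
  case (Suc n)
  then show ?case using assms[of "(f ^^ Suc n) x"] by simp
qed (simp add: assms)

text \<open>The claims need each other: monotonicity in x at limits uses monotonicity in the index,
  which at successors uses growth and monotonicity in x.\<close>

lemma fast_mono_aux:
  "(\<forall>x. x < fast \<alpha> x) \<and> mono (fast \<alpha>) \<and> (\<forall>\<beta> x. reach0 \<beta> \<alpha> \<longrightarrow> fast \<beta> x \<le> fast \<alpha> x)"
proof (induction \<alpha> rule: ordn_induct)
  case zero
  show ?case by (auto simp: fast_0 mono_def dest: reach0_0)
next
  case (succ \<alpha>)
  then have less: "x < fast \<alpha> x" and mono: "mono (fast \<alpha>)"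
    and reach: "reach0 \<beta> \<alpha> \<Longrightarrow> fast \<beta> x \<le> fast \<alpha> x" for x \<beta> by auto
  have funpow: "y < (fast \<alpha> ^^ Suc n) y" for n y
    using less by (rule less_funpow_Suc)
  have step: "fast (succ \<alpha>) x \<le> fast (succ \<alpha>) (Suc x)" for x
  proof -
    \<comment> \<open>First raise the argument with the number of iterations kept, then add the
      missing iteration.\<close>
    have "fast (succ \<alpha>) x \<le> (fast \<alpha> ^^ Suc x) (Suc x)"
      by (simp only: fast_succ Suc_eq_plus1[symmetric], rule funpow_le_funpow[OF mono]) auto
    also have "\<dots> \<le> fast (succ \<alpha>) (Suc x)"
      using less[of "(fast \<alpha> ^^ Suc x) (Suc x)"] by (simp add: fast_succ)
    finally show ?thesis .
  qed
  have le: "fast \<alpha> x \<le> fast (succ \<alpha>) x" for x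
  proof -
    have "x \<le> (fast \<alpha> ^^ x) x" using funpow[of x "x - 1"] by (cases x) auto
    then show ?thesis using mono by (simp add: fast_succ monoD)
  qed
  show ?case
  proof (intro conjI allI impI)
    show "mono (fast (succ \<alpha>))" using step by (simp add: mono_iff_le_Suc)
    show "x < fast (succ \<alpha>) x" for x using less le by (rule less_le_trans)
    show "fast \<beta> x \<le> fast (succ \<alpha>) x" if "reach0 \<beta> (succ \<alpha>)" for \<beta> x
      using reach0_succ[OF that] reach[of \<beta> x] le[of x] by auto
  qed
next
  case (limit \<mu>)
  then have less: "y < fast (fund \<mu> x) y" and mono: "mono (fast (fund \<mu> x))"
    and reach: "reach0 \<beta> (fund \<mu> x) \<Longrightarrow> fast \<beta> y \<le> fast (fund \<mu> x) y" for x y \<beta> by auto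
  \<comment> \<open>Raise the index from \<open>fund \<mu> x\<close> to \<open>fund \<mu> y\<close>
    at argument x, then raise the argument.\<close>
  have "fast \<mu> x \<le> fast \<mu> y" if "x \<le> y" for x y
    using order_trans[OF reach[OF reach0_fund_mono[OF limit.hyps that]] monoD[OF mono that]]
    by (simp only: fast_limit[OF limit.hyps])
  then have "mono (fast \<mu>)" by (rule monoI)
  moreover have "fast \<beta> x \<le> fast \<mu> x" if "reach0 \<beta> \<mu>" for \<beta> x
    using reach0_fund[OF that limit.hyps, of x] reach fast_limit[OF limit.hyps] by auto
  moreover have "x < fast \<mu> x" for x using less by (simp only: fast_limit[OF limit.hyps])
  ultimately show ?case by blast
qed

lemmas fast_greater = fast_mono_aux[THEN conjunct1, rule_format]
lemmas mono_fast = fast_mono_aux[THEN conjunct2, THEN conjunct1]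

section \<open>Monotonicity of the Ackermann functions\<close>

lemma Suc_le_power_2: "Suc n \<le> (2::nat) ^ n"
  by (simp add: Suc_le_eq)

lemma power_le_funpow:
  fixes f :: "nat \<Rightarrow> nat"
  assumes "\<And>x. 2 * x \<le> f x"
  shows "2 ^ n * x \<le> (f ^^ n) x"
proof (induction n)
  case (Suc n)
  then show ?case using assms[of "(f ^^ n) x"] by simp
qed simp

text \<open>
  The bound at 0 is what makes \<open>ack \<alpha> 0 \<le> ack (succ \<alpha>) 0 = 1\<close> true; the value \<open>ack 0 x = 0\<close> makes
  monotonicity in the index hold for index 0 as well.
\<close>

lemma ack_mono_aux:
  "(\<alpha> \<noteq> 0 \<longrightarrow> (\<forall>x. 2 * x \<le> ack \<alpha> x)) \<and> ack \<alpha> 0 \<le> 1 \<and> mono (ack \<alpha>) \<and>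
   (\<forall>\<beta> x. reach0 \<beta> \<alpha> \<longrightarrow> ack \<beta> x \<le> ack \<alpha> x)"
proof (induction \<alpha> rule: ordn_induct)
  case zero
  have "ack 0 x = 0" for x by (subst ack.simps) simp
  then show ?case by (auto simp: mono_def dest: reach0_0)
next
  case (succ \<alpha>)
  show ?case
  proof (cases "\<alpha> = 0")
    \<comment> \<open>Index 1 is a base case of its own, not an iterate of the dummy
      \<open>ack 0\<close>.\<close>
    case True
    then have "ack (succ \<alpha>) x = 2 * x" for x by (simp add: ack_1 flip: one_eq_succ_0)
    moreover have "ack 0 x = 0" for x by (subst ack.simps) simp
    ultimately show ?thesis
      using True by (auto simp: mono_def dest!: reach0_succ dest: reach0_0)
  next
    case False
    with succ have double: "2 * x \<le> ack \<alpha> x" and zero: "ack \<alpha> 0 \<le> 1" and mono: "mono (ack \<alpha>)"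
      and reach: "reach0 \<beta> \<alpha> \<Longrightarrow> ack \<beta> x \<le> ack \<alpha> x" for x \<beta> by auto
    have power: "2 ^ n \<le> (ack \<alpha> ^^ n) 1" for n
      using power_le_funpow[of "ack \<alpha>" n 1] double by simp
    have double': "2 * x \<le> ack (succ \<alpha>) x" for x
    proof (cases x)
      case (Suc n)
      have "2 * Suc n \<le> 2 ^ Suc n" unfolding power_Suc by (rule mult_le_mono2[OF Suc_le_power_2])
      also have "\<dots> \<le> ack (succ \<alpha>) x" using power[of x] False Suc by (simp add: ack_succ)
      finally show ?thesis using Suc by simp
    qed simp
    have step: "ack (succ \<alpha>) x \<le> ack (succ \<alpha>) (Suc x)" for x
      using double[of "(ack \<alpha> ^^ x) 1"] False by (simp add: ack_succ)
    \<comment> \<open>For x = n + 1, the first n iterations already carry 1 to at least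
      \<open>2 ^ n\<close>, hence to at least x; one application remains.\<close>
    have le: "ack \<alpha> x \<le> ack (succ \<alpha>) x" for x
    proof (cases x)
      case (Suc n)
      have "Suc n \<le> (ack \<alpha> ^^ n) 1"
        using Suc_le_power_2 power by (rule order_trans)
      then show ?thesis using Suc False mono by (simp add: ack_succ monoD)
    qed (use zero False in \<open>simp add: ack_succ\<close>)
    show ?thesis
    proof (intro conjI allI impI)
      show "mono (ack (succ \<alpha>))" using step by (simp add: mono_iff_le_Suc)
      show "ack (succ \<alpha>) 0 \<le> 1" using False by (simp add: ack_succ)
      show "ack \<beta> x \<le> ack (succ \<alpha>) x" if "reach0 \<beta> (succ \<alpha>)" for \<beta> x
        using reach0_succ[OF that] reach[of \<beta> x] le[of x] by auto
    qed (rule double')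
  qed
next
  case (limit \<mu>)
  then have double: "2 * y \<le> ack (fund \<mu> x) y" and zero: "ack (fund \<mu> x) 0 \<le> 1"
    and mono: "mono (ack (fund \<mu> x))"
    and reach: "reach0 \<beta> (fund \<mu> x) \<Longrightarrow> ack \<beta> y \<le> ack (fund \<mu> x) y" for x y \<beta>
    using fund_neq_0 by auto
  have "ack \<mu> x \<le> ack \<mu> y" if "x \<le> y" for x y
    using order_trans[OF reach[OF reach0_fund_mono[OF limit.hyps that]] monoD[OF mono that]]
    by (simp only: ack_limit[OF limit.hyps])
  then have "mono (ack \<mu>)" by (rule monoI)
  moreover have "ack \<beta> x \<le> ack \<mu> x" if "reach0 \<beta> \<mu>" for \<beta> x
    using reach0_fund[OF that limit.hyps, of x] reach ack_limit[OF limit.hyps] by auto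
  moreover have "2 * x \<le> ack \<mu> x" and "ack \<mu> 0 \<le> 1" for x
    using double zero by (simp_all only: ack_limit[OF limit.hyps])
  ultimately show ?case by blast
qed

lemma double_le_ack: "\<alpha> \<noteq> 0 \<Longrightarrow> 2 * x \<le> ack \<alpha> x"
  using ack_mono_aux by simp

lemma mono_ack: "mono (ack \<alpha>)"
  using ack_mono_aux by simp

lemma ack_reach0: "reach0 \<beta> \<alpha> \<Longrightarrow> ack \<beta> x \<le> ack \<alpha> x"
  using ack_mono_aux by simp

section \<open>Pointwise comparison of the two families\<close>

lemma fast_1: "fast 1 x = 2 * x + 1"
proof -
  have "(fast 0 ^^ n) x = x + n" for n by (induction n) (simp_all add: fast_0)
  then show ?thesis unfolding one_eq_succ_0 fast_succ by (simp add: fast_0)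
qed

lemma ack_le_fast: "ack \<alpha> x \<le> fast \<alpha> x"
proof (induction \<alpha> arbitrary: x rule: ordn_induct)
  case zero
  show ?case by (subst ack.simps) simp
next
  case (succ \<alpha>)
  show ?case
  proof (cases "\<alpha> = 0")
    case True
    then show ?thesis by (simp add: ack_1 fast_1 flip: one_eq_succ_0)
  next
    case False
    have "ack (succ \<alpha>) x = (ack \<alpha> ^^ x) 1" using False by (rule ack_succ)
    \<comment> \<open>F is iterated once more than A; the extra application lifts the start above 1,
      even for x = 0.\<close>
    also have "\<dots> \<le> (fast \<alpha> ^^ x) (fast \<alpha> x)"
      using mono_fast succ fast_greater[of x \<alpha>] by (intro funpow_le_funpow) auto
    also have "\<dots> = fast (succ \<alpha>) x" by (simp add: fast_succ funpow_swap1)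
    finally show ?thesis .
  qed
next
  case (limit \<mu>)
  then show ?case by (simp add: fast_limit ack_limit)
qed

text \<open>The bound reproduces itself at successors: \<open>5 * x\<close> applications of A
  simulate x applications of F, one more the last F, and \<open>x + 4\<close> lead from 1 to the
  start \<open>6 * x + 5\<close>. The sum is again \<open>6 * x + 5\<close>.\<close>

lemma fast_le_ack: "\<alpha> \<noteq> 0 \<Longrightarrow> fast \<alpha> x \<le> ack \<alpha> (6 * x + 5)"
proof (induction \<alpha> arbitrary: x rule: ordn_induct)
  case zero
  then show ?case by simp
next
  case (succ \<alpha>)
  show ?case
  proof (cases "\<alpha> = 0")
    case True
    then show ?thesis by (simp add: ack_1 fast_1 flip: one_eq_succ_0)
  next
    case False
    let ?A = "ack \<alpha>" and ?F = "fast \<alpha>"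
    have power: "2 ^ n * y \<le> (?A ^^ n) y" for n y
      using double_le_ack[OF False] by (rule power_le_funpow)
    have mono: "mono (?A ^^ n)" for n
      using mono_ack by (simp add: funpow_mono mono_def)
    \<comment> \<open>One F costs five A: the first bounds the value of F, the other four, each at
      least doubling, absorb the map z to \<open>6 * z + 5\<close>.\<close>
    have iter: "6 * (?F ^^ n) x + 5 \<le> (?A ^^ (5 * n)) (6 * x + 5)" for n
    proof (induction n)
      case (Suc n)
      define y where "y = (?F ^^ n) x"
      define z where "z = ?A (6 * y + 5)"
      have "2 * (6 * y + 5) \<le> z"
        unfolding z_def using False by (rule double_le_ack)
      then have "6 * z + 5 \<le> 2 ^ 4 * z" by simp
      moreover have "6 * ?F y + 5 \<le> 6 * z + 5"
        using succ.IH[OF False, of y] by (simp add: z_def)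
      ultimately have "6 * ?F y + 5 \<le> (?A ^^ 4) z" using power[of 4 z] by linarith
      also have "\<dots> = (?A ^^ 5) (6 * y + 5)"
        by (simp add: z_def eval_nat_numeral)
      also have "\<dots> \<le> (?A ^^ 5) ((?A ^^ (5 * n)) (6 * x + 5))"
        using mono Suc unfolding y_def by (rule monoD)
      also have "\<dots> = (?A ^^ (5 * Suc n)) (6 * x + 5)"
        by (simp only: mult_Suc_right funpow_add o_apply)
      finally show ?case by (simp add: y_def)
    qed simp
    have "6 * x + 5 \<le> 2 ^ x * 2 ^ 4" using Suc_le_power_2[of x] by simp
    also have "\<dots> = 2 ^ (x + 4)" by (rule power_add[symmetric])
    also have "\<dots> \<le> (?A ^^ (x + 4)) 1" using power[of "x + 4" 1] by simp
    finally have base: "6 * x + 5 \<le> (?A ^^ (x + 4)) 1" .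
    \<comment> \<open>The last F is split off: no further F follows, so a single A suffices for
      it.\<close>
    have "fast (succ \<alpha>) x = ?F ((?F ^^ x) x)" by (simp add: fast_succ)
    also have "\<dots> \<le> ?A (6 * (?F ^^ x) x + 5)" using False by (rule succ.IH)
    also have "\<dots> \<le> ?A ((?A ^^ (5 * x)) (6 * x + 5))" using mono_ack iter by (rule monoD)
    also have "\<dots> = (?A ^^ (5 * x + 1)) (6 * x + 5)" by simp
    also have "\<dots> \<le> (?A ^^ (5 * x + 1)) ((?A ^^ (x + 4)) 1)" using mono base by (rule monoD)
    also have "\<dots> = (?A ^^ (5 * x + 1 + (x + 4))) 1"
      by (simp only: funpow_add o_apply)
    also have "\<dots> = ack (succ \<alpha>) (6 * x + 5)"
      by (simp add: ack_succ[OF False] algebra_simps)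
    finally show ?thesis .
  qed
next
  case (limit \<mu>)
  have "fast \<mu> x \<le> ack (fund \<mu> x) (6 * x + 5)"
    using limit.IH fund_neq_0[OF limit.hyps] by (simp add: fast_limit limit.hyps)
  \<comment> \<open>The larger argument of \<open>ack \<mu>\<close> also selects a later element of
    the fundamental sequence.\<close>
  also have "\<dots> \<le> ack (fund \<mu> (6 * x + 5)) (6 * x + 5)"
    by (intro ack_reach0 reach0_fund_mono limit.hyps) simp
  also have "\<dots> = ack \<mu> (6 * x + 5)" by (simp add: ack_limit limit.hyps)
  finally show ?case .
qed

section \<open>Affine closure of the Grzegorczyk classes and transfer to time classes\<close>

lemma fast_at_0: "fast \<alpha> 0 = 1"
  by (induction \<alpha> rule: ordn_induct) (simp_all add: fast_0 fast_succ fast_limit)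

text \<open>The only constant generator is 0; applying \<open>fast \<alpha>\<close> to it yields 1
  at every index.\<close>

lemma grz_one: "grz \<alpha> k (\<lambda>_. 1)"
proof -
  have "grz \<alpha> k (\<lambda>xs. (\<lambda>xs. fast \<alpha> (xs ! 0)) (map (\<lambda>g. g xs) [\<lambda>_. 0]))"
    by (rule grz.subst) (simp_all add: grz.fast grz.zero flip: One_nat_def)
  then show ?thesis by (simp add: fast_at_0)
qed

lemma grz_add:
  assumes "grz \<alpha> k f" and "grz \<alpha> k g"
  shows "grz \<alpha> k (\<lambda>xs. f xs + g xs)"
proof -
  have "grz \<alpha> k (\<lambda>xs. (\<lambda>xs. xs ! 0 + xs ! 1) (map (\<lambda>g. g xs) [f, g]))"
    by (rule grz.subst) (use assms grz.add in \<open>simp_all add: numeral_2_eq_2\<close>)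
  then show ?thesis by simp
qed

lemma grz_const: "grz \<alpha> k (\<lambda>_. n)"
proof (induction n)
  case (Suc n)
  then show ?case using grz_add[OF Suc grz_one] by simp
qed (rule grz.zero)

lemma grz_mult_const: "grz \<alpha> k f \<Longrightarrow> grz \<alpha> k (\<lambda>xs. n * f xs)"
proof (induction n)
  case (Suc n)
  then show ?case using grz_add[of \<alpha> k f] by simp
qed (simp add: grz.zero)

text \<open>The same \<beta> serves as witness, since each single class is closed under sums and
  contains the constants.\<close>

lemma grz_below_affine:
  assumes "p \<in> grz_below \<alpha>"
  shows "(\<lambda>n. a * p n + b) \<in> grz_below \<alpha>"
proof -
  from assms obtain \<beta> f where \<beta>: "cnf \<beta>" "\<beta> < \<alpha>" and f: "grz \<beta> 1 f" and p: "p = (\<lambda>n. f [n])"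
    unfolding grz_below_def by blast
  have "grz \<beta> 1 (\<lambda>xs. a * f xs + b)" by (rule grz_add[OF grz_mult_const[OF f] grz_const])
  moreover have "(\<lambda>n. a * p n + b) = (\<lambda>n. (\<lambda>xs. a * f xs + b) [n])" by (simp add: p)
  ultimately show ?thesis unfolding grz_below_def using \<beta> by blast
qed

lemma DTime_mono: "(\<And>n. s n \<le> t n) \<Longrightarrow> DTime s \<subseteq> DTime t"
  unfolding DTime_def decides_in_time_def by (auto simp: Let_def) (meson order_trans)

theorem theorem4p1:
  fixes \<alpha> :: ordn
  assumes "cnf \<alpha>" and "0 < \<alpha>"
  shows "(ack_class \<alpha> :: 'a::finite list set set) = fast_class \<alpha>"
proof
  show "(ack_class \<alpha> :: 'a list set set) \<subseteq> fast_class \<alpha>"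
    unfolding ack_class_def fast_class_def by (intro UN_mono order_refl DTime_mono ack_le_fast)
  have "DTime (\<lambda>n. fast \<alpha> (p n)) \<subseteq> (ack_class \<alpha> :: 'a list set set)" if "p \<in> grz_below \<alpha>" for p
  proof -
    have "DTime (\<lambda>n. fast \<alpha> (p n)) \<subseteq> (DTime (\<lambda>n. ack \<alpha> (6 * p n + 5)) :: 'a list set set)"
      using assms(2) by (intro DTime_mono fast_le_ack) simp
    also have "\<dots> \<subseteq> ack_class \<alpha>"
      unfolding ack_class_def using grz_below_affine[OF that] by (rule UN_upper)
    finally show ?thesis .
  qed
  then show "fast_class \<alpha> \<subseteq> (ack_class \<alpha> :: 'a list set set)"
    unfolding fast_class_def by (rule UN_least)
qed

end
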